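(* (i) If $A\in(\ell_1(\Delta^{(\tilde\alpha)}),c_0)$, then $$\|L_A\|_\chi=\lim_{r\to\infty}\sup_{n\ge r}\Big(\sup_k|\hat a_{nk}|\Big).$$ (ii) If $A\in(\ell_1(\Delta^{(\tilde\alpha)}),c)$, then, with $\hat\alpha_k=\lim_{n\to\infty}\hat a_{nk}$ for $k=0,1,\dots$, $$\frac12\lim_{r\to\infty}\sup_{n\ge r}\Big(\sup_k|\hat a_{nk}-\hat\alpha_k|\Big)\le\|L_A\|_\chi\le\lim_{r\to\infty}\sup_{n\ge r}\Big(\sup_k|\hat a_{nk}-\hat\alpha_k|\Big).$$
   Context: $\omega$ is the set of all complex sequences $x=(x_k)_{k\ge0}$; $c_0$ and $c$ (null and convergent sequences) carry the sup norm, and $\ell_1$ its usual norm. Fix a fraction $\tilde\alpha$ (a real non-integer number). For $x\in\omega$ put $$(\Delta^{(\tilde\alpha)}x)_k=\sum_{i=0}^{k}(-1)^i\frac{\Gamma(\tilde\alpha+1)}{i!\,\Gamma(\tilde\alpha-i+1)}x_{k-i}$$ (terms with negative index are zero). Then $\ell_1(\Delta^{(\tilde\alpha)})=\{x\in\omega:\Delta^{(\tilde\alpha)}x\in\ell_1\}$, a Banach space with norm $\|x\|=\|\Delta^{(\tilde\alpha)}x\|_{\ell_1}$. For an infinite complex matrix $A=(a_{nk})_{n,k\ge0}$ and $X,Y\subset\omega$, $A\in(X,Y)$ means that for every $x\in X$ the series $A_nx=\sum_{k=0}^\infty a_{nk}x_k$ converges for all $n$ and $Ax=(A_nx)_{n\ge0}\in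 Y$. $L_A:X\to Y$ denotes the (bounded) operator $L_A(x)=Ax$. The matrix $\hat A=(\hat a_{nk})$ associated with $A$ is $$\hat a_{nk}=\sum_{j=k}^\infty(-1)^{j-k}\frac{\Gamma(-\tilde\alpha+1)}{(j-k)!\,\Gamma(-\tilde\alpha-j+k+1)}a_{nj}$$ (these series converge whenever $A$ maps $\ell_1(\Delta^{(\tilde\alpha)})$ into some subset of $\omega$). The Hausdorff measure of noncompactness of a bounded subset $Q$ of a metric space is $\chi(Q)=\inf\{\epsilon>0: Q$ is covered by finitely many open balls of radii less than $\epsilon\}$. For a bounded linear operator $L:X\to Y$ between Banach spaces, $\|L\|_\chi=\inf\{C\ge0:\chi(L(Q))\le C\chi(Q)$ for all bounded $Q\subset X\}$; equivalently $\|L\|_\chi=\chi(L(S_X))$ with $S_X$ the unit sphere of $X$. *)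

theory Defs
  imports "HOL-Analysis.Analysis"
begin

section \<open>Sequence spaces\<close>

type_synonym cseq = "nat \<Rightarrow> complex"

definition c0_space :: "cseq set" where
  "c0_space = {x. x \<longlonglongrightarrow> 0}"

definition c_space :: "cseq set" where
  "c_space = {x. convergent x}"

definition l1_space :: "cseq set" where
  "l1_space = {x. summable (\<lambda>k. cmod (x k))}"

definition sup_norm :: "cseq \<Rightarrow> real" where
  "sup_norm x = (SUP k. cmod (x k))"

definition l1_norm :: "cseq \<Rightarrow> real" where
  "l1_norm x = (\<Sum>k. cmod (x k))"

text \<open>For non-integer \<open>\<alpha>\<close> no argument of \<open>Gamma\<close> below is a pole.\<close>

definition frac_coeff :: "real \<Rightarrow> nat \<Rightarrow> real" where
  "frac_coeff \<alpha> i = (-1) ^ i * (Gamma (\<alpha> + 1) / (fact i * Gamma (\<alpha> - real i + 1)))"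

definition frac_diff :: "real \<Rightarrow> cseq \<Rightarrow> cseq" where
  "frac_diff \<alpha> x = (\<lambda>k. \<Sum>i\<le>k. complex_of_real (frac_coeff \<alpha> i) * x (k - i))"

definition l1_frac_space :: "real \<Rightarrow> cseq set" where
  "l1_frac_space \<alpha> = {x. frac_diff \<alpha> x \<in> l1_space}"

definition l1_frac_norm :: "real \<Rightarrow> cseq \<Rightarrow> real" where
  "l1_frac_norm \<alpha> x = l1_norm (frac_diff \<alpha> x)"

text \<open>The metric of a normed sequence space with carrier \<open>X\<close> and norm \<open>N\<close>. The value 0 off the
  carrier is immaterial; it is needed because the locale \<open>Metric_space\<close> demands nonnegativity and
  symmetry on the whole type.\<close>

definition norm_metric :: "cseq set \<Rightarrow> (cseq \<Rightarrow> real) \<Rightarrow> cseq \<Rightarrow> cseq \<Rightarrow> real" where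
  "norm_metric X N x y = (if x \<in> X \<and> y \<in> X then N (\<lambda>k. x k - y k) else 0)"

section \<open>Infinite matrices\<close>

definition mat_apply :: "(nat \<Rightarrow> nat \<Rightarrow> complex) \<Rightarrow> cseq \<Rightarrow> cseq" where
  "mat_apply A x = (\<lambda>n. \<Sum>k. A n k * x k)"

definition matrix_class :: "cseq set \<Rightarrow> cseq set \<Rightarrow> (nat \<Rightarrow> nat \<Rightarrow> complex) set" where
  "matrix_class X Y =
     {A. \<forall>x\<in>X. (\<forall>n. summable (\<lambda>k. A n k * x k)) \<and> mat_apply A x \<in> Y}"

text \<open>The series over \<open>j \<ge> k\<close> is reindexed by \<open>i = j - k\<close>; its coefficients are those of the
  fractional difference of order \<open>-\<alpha>\<close>.\<close>

definition assoc_matrix ::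
    "real \<Rightarrow> (nat \<Rightarrow> nat \<Rightarrow> complex) \<Rightarrow> nat \<Rightarrow> nat \<Rightarrow> complex" where
  "assoc_matrix \<alpha> A n k = (\<Sum>i. complex_of_real (frac_coeff (-\<alpha>) i) * A n (k + i))"

section \<open>Hausdorff measure of noncompactness\<close>

text \<open>In the covering, \<open>F\<close> is a finite set of pairs (centre, radius); the centres may be
  arbitrary points of the space \<open>M\<close>. Meaningful for bounded \<open>Q\<close> only.\<close>

definition hausdorff_mnc :: "'a set \<Rightarrow> ('a \<Rightarrow> 'a \<Rightarrow> real) \<Rightarrow> 'a set \<Rightarrow> real" where
  "hausdorff_mnc M d Q =
     Inf {\<epsilon>. 0 < \<epsilon> \<and>
            (\<exists>F. finite F \<and> F \<subseteq> M \<times> {0<..<\<epsilon>} \<and>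
                 Q \<subseteq> (\<Union>(x, r)\<in>F. Metric_space.mball M d x r))}"

text \<open>Meaningful for bounded linear \<open>L\<close> only.\<close>

definition mnc_norm ::
    "'a set \<Rightarrow> ('a \<Rightarrow> 'a \<Rightarrow> real) \<Rightarrow> 'b set \<Rightarrow> ('b \<Rightarrow> 'b \<Rightarrow> real) \<Rightarrow> ('a \<Rightarrow> 'b) \<Rightarrow> real" where
  "mnc_norm X d Y e L =
     Inf {C. 0 \<le> C \<and>
            (\<forall>Q. Metric_space.mbounded X d Q \<longrightarrow>
                 hausdorff_mnc Y e (L ` Q) \<le> C * hausdorff_mnc X d Q)}"

abbreviation l1_frac_metric :: "real \<Rightarrow> cseq \<Rightarrow> cseq \<Rightarrow> real" where
  "l1_frac_metric \<alpha> \<equiv> norm_metric (l1_frac_space \<alpha>) (l1_frac_norm \<alpha>)"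

abbreviation c0_metric :: "cseq \<Rightarrow> cseq \<Rightarrow> real" where
  "c0_metric \<equiv> norm_metric c0_space sup_norm"

abbreviation c_metric :: "cseq \<Rightarrow> cseq \<Rightarrow> real" where
  "c_metric \<equiv> norm_metric c_space sup_norm"

section \<open>The metrics are metrics\<close>

lemma Metric_space_norm_metric:
  assumes diff: "\<And>x y. x \<in> X \<Longrightarrow> y \<in> X \<Longrightarrow> (\<lambda>k. x k - y k) \<in> X"
    and nonneg: "\<And>x. x \<in> X \<Longrightarrow> 0 \<le> N x"
    and minus: "\<And>x. x \<in> X \<Longrightarrow> N (\<lambda>k. - x k) = N x"
    and zero: "\<And>x. x \<in> X \<Longrightarrow> N x = 0 \<longleftrightarrow> (\<forall>k. x k = 0)"
    and triangle: "\<And>x y. x \<in> X \<Longrightarrow> y \<in> X \<Longrightarrow> N (\<lambda>k. x k + y k) \<le> N x + N y"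
  shows "Metric_space X (norm_metric X N)"
proof
  fix x y z
  show "0 \<le> norm_metric X N x y"
    by (simp add: norm_metric_def diff nonneg)
  show "norm_metric X N x y = norm_metric X N y x"
    using minus[OF diff, of x y] by (auto simp: norm_metric_def)
  show "norm_metric X N x y = 0 \<longleftrightarrow> x = y" if "x \<in> X" "y \<in> X"
    using that zero[OF diff, of x y] by (auto simp: norm_metric_def)
  show "norm_metric X N x z \<le> norm_metric X N x y + norm_metric X N y z"
    if "x \<in> X" "y \<in> X" "z \<in> X"
    using that triangle[OF diff diff, of x y y z] by (auto simp: norm_metric_def)
qed

lemma convergent_bdd_above_cmod:
  assumes "convergent (x :: cseq)"
  shows "bdd_above (range (\<lambda>k. cmod (x k)))"
  using convergent_imp_Bseq[OF assms] by (auto simp: Bseq_def bdd_above_def)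

lemma sup_norm_metric_aux:
  assumes bdd: "\<And>x. x \<in> X \<Longrightarrow> bdd_above (range (\<lambda>k. cmod (x k)))"
    and diff: "\<And>x y. x \<in> X \<Longrightarrow> y \<in> X \<Longrightarrow> (\<lambda>k. x k - y k) \<in> X"
  shows "Metric_space X (norm_metric X sup_norm)"
proof (rule Metric_space_norm_metric)
  have le: "cmod (x k) \<le> sup_norm x" if "x \<in> X" for x k
    unfolding sup_norm_def using bdd[OF that] by (rule cSUP_upper[OF UNIV_I])
  show "0 \<le> sup_norm x" if "x \<in> X" for x
    using le[OF that, of 0] norm_ge_zero[of "x 0"] by linarith
  show "sup_norm x = 0 \<longleftrightarrow> (\<forall>k. x k = 0)" if "x \<in> X" for x
    using le[OF that] by (auto simp: sup_norm_def)
  show "sup_norm (\<lambda>k. x k + y k) \<le> sup_norm x + sup_norm y" if "x \<in> X" "y \<in> X" for x y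
    unfolding sup_norm_def[of "\<lambda>k. x k + y k"]
    by (rule cSUP_least) (auto intro: norm_triangle_le add_mono le that)
qed (auto simp: diff sup_norm_def)

lemma Metric_space_c0: "Metric_space c0_space c0_metric"
proof (rule sup_norm_metric_aux)
  show "bdd_above (range (\<lambda>k. cmod (x k)))" if "x \<in> c0_space" for x
    using that by (intro convergent_bdd_above_cmod) (auto simp: c0_space_def convergent_def)
  show "(\<lambda>k. x k - y k) \<in> c0_space" if "x \<in> c0_space" "y \<in> c0_space" for x y
    using that tendsto_diff[of x 0 sequentially y 0] by (simp add: c0_space_def)
qed

lemma Metric_space_c: "Metric_space c_space c_metric"
  by (rule sup_norm_metric_aux)
    (auto simp: c_space_def intro: convergent_bdd_above_cmod convergent_diff)

lemma frac_coeff_0: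
  assumes "\<alpha> \<notin> \<int>"
  shows "frac_coeff \<alpha> 0 = 1"
proof -
  have "\<alpha> + 1 \<notin> \<int>"
    using assms Ints_diff[of "\<alpha> + 1" 1] by auto
  then have "Gamma (\<alpha> + 1) \<noteq> 0"
    using nonpos_Ints_subset_Ints by (auto simp: Gamma_eq_zero_iff)
  then show ?thesis
    by (simp add: frac_coeff_def)
qed

lemma frac_diff_eq_0_iff:
  assumes "\<alpha> \<notin> \<int>"
  shows "(\<forall>k. frac_diff \<alpha> x k = 0) \<longleftrightarrow> (\<forall>k. x k = 0)"
proof
  assume *: "\<forall>k. frac_diff \<alpha> x k = 0"
  show "\<forall>k. x k = 0"
  proof
    fix k
    show "x k = 0"
    proof (induction k rule: less_induct)
      case (less k)
      have "frac_diff \<alpha> x k =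
          (\<Sum>i\<le>k. if i = 0 then complex_of_real (frac_coeff \<alpha> 0) * x k else 0)"
        unfolding frac_diff_def using less by (intro sum.cong) auto
      also have "\<dots> = x k"
        by (simp add: frac_coeff_0[OF assms])
      finally show ?case
        using * by simp
    qed
  qed
qed (simp add: frac_diff_def)

lemma Metric_space_l1_frac:
  assumes "\<alpha> \<notin> \<int>"
  shows "Metric_space (l1_frac_space \<alpha>) (l1_frac_metric \<alpha>)"
proof (rule Metric_space_norm_metric)
  have add: "frac_diff \<alpha> (\<lambda>k. x k + y k) k = frac_diff \<alpha> x k + frac_diff \<alpha> y k" for x y k
    by (simp add: frac_diff_def algebra_simps sum.distrib)
  have minus: "frac_diff \<alpha> (\<lambda>k. - x k) k = - frac_diff \<alpha> x k" for x k
    by (simp add: frac_diff_def sum_negf)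
  have diff: "frac_diff \<alpha> (\<lambda>k. x k - y k) k = frac_diff \<alpha> x k - frac_diff \<alpha> y k" for x y k
    by (simp add: frac_diff_def algebra_simps sum_subtractf)
  have sum: "summable (\<lambda>k. cmod (frac_diff \<alpha> x k))" if "x \<in> l1_frac_space \<alpha>" for x
    using that by (simp add: l1_frac_space_def l1_space_def)
  show "(\<lambda>k. x k - y k) \<in> l1_frac_space \<alpha>"
    if "x \<in> l1_frac_space \<alpha>" "y \<in> l1_frac_space \<alpha>" for x y
    unfolding l1_frac_space_def l1_space_def mem_Collect_eq
    by (rule summable_comparison_test'[OF summable_add[OF sum[OF that(1)] sum[OF that(2)]], of 0])
       (simp add: diff norm_triangle_ineq4)
  show "0 \<le> l1_frac_norm \<alpha> x" if "x \<in> l1_frac_space \<alpha>" for x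
    unfolding l1_frac_norm_def l1_norm_def by (rule suminf_nonneg[OF sum[OF that]]) simp
  show "l1_frac_norm \<alpha> (\<lambda>k. - x k) = l1_frac_norm \<alpha> x" for x
    by (simp add: l1_frac_norm_def l1_norm_def minus)
  show "l1_frac_norm \<alpha> x = 0 \<longleftrightarrow> (\<forall>k. x k = 0)" if "x \<in> l1_frac_space \<alpha>" for x
    using suminf_eq_zero_iff[OF sum[OF that]] frac_diff_eq_0_iff[OF assms, of x]
    by (simp add: l1_frac_norm_def l1_norm_def)
  show "l1_frac_norm \<alpha> (\<lambda>k. x k + y k) \<le> l1_frac_norm \<alpha> x + l1_frac_norm \<alpha> y"
    if "x \<in> l1_frac_space \<alpha>" "y \<in> l1_frac_space \<alpha>" for x y
  proof -
    have s: "summable (\<lambda>k. cmod (frac_diff \<alpha> x k) + cmod (frac_diff \<alpha> y k))"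
      by (intro summable_add sum that)
    have "(\<Sum>k. cmod (frac_diff \<alpha> (\<lambda>k. x k + y k) k))
        \<le> (\<Sum>k. cmod (frac_diff \<alpha> x k) + cmod (frac_diff \<alpha> y k))"
      by (rule suminf_le[OF _ summable_comparison_test'[OF s, of 0] s])
         (simp_all add: add norm_triangle_ineq)
    then show ?thesis
      using suminf_add[OF sum[OF that(1)] sum[OF that(2)]]
      by (simp add: l1_frac_norm_def l1_norm_def)
  qed
qed

end

theory Submission
  imports Defs
begin

text \<open>
  The coefficients of \<open>\<Delta>\<close> are those of a binomial series, so \<open>\<Delta>\<close> maps its domain
  bijectively, hence isometrically, onto \<open>\<ell>\<^sub>1\<close>. Uniform boundedness on \<open>\<ell>\<^sub>1\<close> (by a
  gliding hump), applied first to the partial sums of one row and then to all rows, shows that the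
  associated matrix \<open>a\<close> is bounded and that \<open>A x = a (\<Delta> x)\<close>. Upper bound: up to a totally
  bounded set, the image of a ball only sees the rows \<open>n \<ge> r\<close> of \<open>a - \<beta>\<close>, where
  \<open>\<beta> k = lim\<^sub>n a n k\<close>. Lower bound: the columns of \<open>a\<close> are images of unit vectors, and finitely
  many convergent sequences approach their limits uniformly.
\<close>

section \<open>Uniform boundedness on \<open>l1_space\<close> by a gliding hump\<close>

lemma unit_in_l1: "(\<lambda>j. if j = k then 1 else 0) \<in> l1_space"
  unfolding l1_space_def mem_Collect_eq by (rule summable_finite[of "{k}"]) auto

text \<open>The numbers \<open>z + w\<close> and \<open>z - w\<close> differ by
  \<open>2 * w\<close>, so the larger of their norms is at least that of \<open>w\<close>.\<close>

lemma sign_choice: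
  fixes z w :: complex
  obtains s :: real where "\<bar>s\<bar> = 1" "cmod w \<le> cmod (z + of_real s * w)"
proof -
  have "(z + w) - (z - w) = 2 * w"
    by simp
  then have "2 * cmod w = cmod ((z + w) - (z - w))"
    by (simp add: norm_mult)
  also have "\<dots> \<le> cmod (z + w) + cmod (z - w)"
    by (rule norm_triangle_ineq4)
  finally have "cmod w \<le> cmod (z + of_real 1 * w) \<or> cmod w \<le> cmod (z + of_real (-1) * w)"
    by auto
  then show thesis
    using that[of 1] that[of "-1"] by auto
qed

text \<open>The signs are fixed one after another, each so that the new diagonal term is not
  cancelled by the earlier part of its row. Row \<open>i\<close> is only summed up to the diagonal,
  so later choices do not disturb it.\<close>

lemma peaking_signs:
  fixes b :: "nat \<Rightarrow> nat \<Rightarrow> complex"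
  obtains s :: "nat \<Rightarrow> real"
  where "\<And>i. \<bar>s i\<bar> = 1" "\<And>i. cmod (b i i) \<le> cmod (\<Sum>l\<le>i. of_real (s l) * b i l)"
proof -
  define P where "P i s \<longleftrightarrow> (\<forall>l. \<bar>s l\<bar> = (1::real)) \<and>
    cmod (b i i) \<le> cmod (\<Sum>l\<le>i. of_real (s l) * b i l)" for i s
  \<comment> \<open>Each state is a whole sign function, of which the values up to \<open>n\<close>
    are final; the diagonal \<open>t l l\<close> is the limit of these functions.\<close>
  have "\<exists>t. \<forall>n. P n (t n) \<and> (\<forall>l\<le>n. t (Suc n) l = t n l)"
  proof (rule dependent_nat_choice)
    show "\<exists>s. P 0 s"
      by (rule exI[of _ "\<lambda>_. 1"]) (simp add: P_def)
    fix s n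
    assume s: "P n s"
    obtain e where e: "\<bar>e\<bar> = 1"
      "cmod (b (Suc n) (Suc n)) \<le>
        cmod ((\<Sum>l\<le>n. of_real (s l) * b (Suc n) l) + of_real e * b (Suc n) (Suc n))"
      by (rule sign_choice)
    have "(\<Sum>l\<le>n. of_real ((s(Suc n := e)) l) * b (Suc n) l) =
        (\<Sum>l\<le>n. of_real (s l) * b (Suc n) l)"
      by (intro sum.cong) auto
    with e s have "P (Suc n) (s(Suc n := e))"
      by (simp add: P_def)
    then show "\<exists>s'. P (Suc n) s' \<and> (\<forall>l\<le>n. s' l = s l)"
      by (intro exI[of _ "s(Suc n := e)"]) auto
  qed
  then obtain t where t: "\<And>n. P n (t n)" "\<And>n l. l \<le> n \<Longrightarrow> t (Suc n) l = t n l"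
    by blast
  have eq: "t n l = t l l" if "l \<le> n" for n l
    using that by (induction rule: dec_induct) (simp_all add: t(2))
  show thesis
  proof (rule that[of "\<lambda>l. t l l"])
    show "\<bar>t i i\<bar> = 1" for i
      using t(1) by (simp add: P_def)
    have "(\<Sum>l\<le>i. of_real (t l l) * b i l) = (\<Sum>l\<le>i. of_real (t i l) * b i l)" for i
      by (intro sum.cong refl) (metis atMost_iff eq)
    then show "cmod (b i i) \<le> cmod (\<Sum>l\<le>i. of_real (t l l) * b i l)" for i
      using t(1)[of i] by (simp add: P_def)
  qed
qed

text \<open>The witness has the entry \<open>s l * (1/3)^l\<close> at position \<open>J l\<close>.
  Let \<open>N\<close> be the norm of the peak entry in row \<open>m i\<close>. The signs keep the
  terms up to \<open>i\<close> at \<open>(1/3)^i * N\<close> or more, while the later terms sum to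
  at most 3/4 of that, since no entry of the row exceeds \<open>3/2 * N\<close>. The remaining
  quarter grows because \<open>N\<close> is at least \<open>4^i\<close>.\<close>

lemma l1_gliding_hump:
  fixes B :: "nat \<Rightarrow> nat \<Rightarrow> complex"
  assumes J: "strict_mono J"
    and big: "\<And>i. 4 ^ i \<le> cmod (B (m i) (J i))"
    and peak: "\<And>i j. cmod (B (m i) j) \<le> 3 / 2 * cmod (B (m i) (J i))"
  shows "\<exists>y\<in>l1_space. \<forall>i. (4 / 3) ^ i / 4 \<le> cmod (\<Sum>j. B (m i) j * y j)"
proof -
  obtain s where s: "\<And>i. \<bar>s i\<bar> = 1"
    "\<And>i. cmod ((1/3)^i * B (m i) (J i)) \<le>
       cmod (\<Sum>l\<le>i. of_real (s l) * ((1/3)^l * B (m i) (J l)))"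
    by (rule peaking_signs[of "\<lambda>i l. (1/3)^l * B (m i) (J l)"]) blast
  define c where "c l = complex_of_real (s l) * (1/3)^l" for l
  define y where "y j = (if j \<in> range J then c (inv J j) else 0)" for j
  have inj: "inj J"
    using J by (rule strict_mono_imp_inj_on)
  have yJ: "y (J l) = c l" for l
    by (simp add: y_def inj)
  have y0: "y j = 0" if "j \<notin> range J" for j
    using that by (simp add: y_def)
  have nc: "cmod (c l) = (1/3)^l" for l
    by (simp add: c_def norm_mult norm_power s norm_divide)
  have geo: "summable (\<lambda>l. (1/3::real)^l)"
    by (rule summable_geometric) simp
  have "summable (\<lambda>l. cmod (y (J l)))"
    using geo by (simp add: yJ nc)
  then have "y \<in> l1_space"
    unfolding l1_space_def
    using summable_mono_reindex[OF J, of "\<lambda>j. cmod (y j)"] by (simp add: y0)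
  moreover have "(4 / 3) ^ i / 4 \<le> cmod (\<Sum>j. B (m i) j * y j)" for i
  proof -
    define N where "N = cmod (B (m i) (J i))"
    define f where "f l = B (m i) (J l) * c l" for l
    have "(\<Sum>j. B (m i) j * y j) = (\<Sum>l. f l)"
      unfolding f_def using suminf_mono_reindex[OF J, of "\<lambda>j. B (m i) j * y j"]
      by (simp add: yJ y0)
    have fle: "cmod (f l) \<le> 3 / 2 * N * (1/3)^l" for l
      unfolding f_def norm_mult nc N_def by (intro mult_right_mono peak) simp
    have sf: "summable (\<lambda>l. cmod (f l))"
    proof (rule summable_comparison_test'[OF summable_mult[OF geo, of "3/2*N"], of 0])
      show "norm (cmod (f l)) \<le> 3 / 2 * N * (1 / 3) ^ l" for l
        using fle[of l] by simp
    qed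
    have "cmod (\<Sum>l. f (l + Suc i)) \<le> (\<Sum>l. cmod (f (l + Suc i)))"
      by (intro summable_norm) (subst summable_iff_shift[of "\<lambda>l. cmod (f l)"], rule sf)
    also have "\<dots> \<le> (\<Sum>l. (3 / 2 * N * (1/3)^Suc i) * (1/3)^l)"
    proof (rule suminf_le)
      show "cmod (f (l + Suc i)) \<le> (3 / 2 * N * (1/3)^Suc i) * (1/3)^l" for l
        using fle[of "l + Suc i"] by (simp add: power_add mult_ac)
      show "summable (\<lambda>l. cmod (f (l + Suc i)))"
        by (subst summable_iff_shift[of "\<lambda>l. cmod (f l)"], rule sf)
    qed (intro summable_mult geo)
    also have "\<dots> = 3 / 4 * N * (1/3)^i"
      by (subst suminf_mult[OF geo], subst suminf_geometric) simp_all
    also have "\<dots> = (1/3)^i * N - (1/3)^i * N / 4"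
      by simp
    finally have tail: "cmod (\<Sum>l. f (l + Suc i)) \<le> (1/3)^i * N - (1/3)^i * N / 4" .
    have head: "(1/3)^i * N \<le> cmod (\<Sum>l\<le>i. f l)"
      using s(2)[of i] by (simp add: f_def c_def N_def norm_mult norm_power norm_divide mult_ac)
    have "(\<Sum>l. f l) = (\<Sum>l. f (l + Suc i)) + (\<Sum>l\<le>i. f l)"
      using suminf_split_initial_segment[OF summable_norm_cancel[OF sf], of "Suc i"]
      by (simp add: lessThan_Suc_atMost)
    then have "cmod (\<Sum>l\<le>i. f l) \<le> cmod (\<Sum>l. f l) + cmod (\<Sum>l. f (l + Suc i))"
      using norm_triangle_ineq4[of "\<Sum>l. f l" "\<Sum>l. f (l + Suc i)"] by simp
    with head tail have "(1/3)^i * N / 4 \<le> cmod (\<Sum>l. f l)"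
      by linarith
    moreover have "(4/3::real)^i \<le> (1/3)^i * N"
    proof -
      have "(4/3::real)^i = (1/3)^i * 4^i"
        by (simp flip: power_mult_distrib)
      then show ?thesis
        using big[of i] by (simp add: N_def)
    qed
    ultimately show ?thesis
      using \<open>(\<Sum>j. B (m i) j * y j) = (\<Sum>l. f l)\<close> by simp
  qed
  ultimately show ?thesis
    by blast
qed

text \<open>Every single column is bounded, so unbounded entries would have to occur ever further to
  the right. This supplies the rows and positions for the hump, and the resulting \<open>y\<close>
  contradicts pointwise boundedness.\<close>

lemma l1_uniform_boundedness:
  fixes B :: "nat \<Rightarrow> nat \<Rightarrow> complex"
  assumes row: "\<And>m. bdd_above (range (\<lambda>j. cmod (B m j)))"
    and pt: "\<And>y. y \<in> l1_space \<Longrightarrow> bdd_above (range (\<lambda>m. cmod (\<Sum>j. B m j * y j)))"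
  shows "\<exists>M. \<forall>m j. cmod (B m j) \<le> M"
proof (rule ccontr)
  assume "\<nexists>M. \<forall>m j. cmod (B m j) \<le> M"
  then have unb: "\<exists>m j. M < cmod (B m j)" for M
    by (meson not_le)
  \<comment> \<open>The unit vectors, as test sequences, bound the columns.\<close>
  have "\<exists>C. \<forall>m. cmod (B m j) \<le> C" for j
  proof -
    have "(\<Sum>j'. B m j' * (if j' = j then 1 else 0)) = B m j" for m
      by (subst suminf_finite[of "{j}"]) auto
    then show ?thesis
      using pt[OF unit_in_l1, of j] by (auto simp: bdd_above_def)
  qed
  then obtain C where C: "\<And>m j. cmod (B m j) \<le> C j"
    by metis
  have step: "\<exists>m j. J < j \<and> T \<le> cmod (B m j) \<and> (\<forall>j'. cmod (B m j') \<le> 3 / 2 * cmod (B m j))"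
    for J :: nat and T :: real
  proof -
    \<comment> \<open>\<open>D\<close> dominates all columns up to \<open>J\<close>, so an entry
      above \<open>D\<close> lies beyond \<open>J\<close>. The factor 3/2 below leaves room to pass
      from a large entry to one above 2/3 of the supremum of its row.\<close>
    define D where "D = max (max T 0) (Max (C ` {..J}))"
    obtain m k where mk: "3 / 2 * D < cmod (B m k)"
      using unb by blast
    define S where "S = (SUP j. cmod (B m j))"
    have le: "cmod (B m j) \<le> S" for j
      unfolding S_def by (rule cSUP_upper[OF UNIV_I row])
    have "0 \<le> D"
      by (simp add: D_def)
    then have "2 / 3 * S < S"
      using mk le[of k] by linarith
    then obtain j where j: "2 / 3 * S < cmod (B m j)"
      unfolding S_def by (subst (asm) less_cSUP_iff[OF UNIV_not_empty row]) blast
    then have "D < cmod (B m j)"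
      using mk le[of k] by linarith
    then have "T \<le> cmod (B m j)" "Max (C ` {..J}) < cmod (B m j)"
      by (auto simp: D_def)
    moreover have "J < j"
    proof (rule ccontr)
      assume "\<not> J < j"
      then have "C j \<le> Max (C ` {..J})"
        by (intro Max_ge) auto
      then show False
        using C[of m j] \<open>Max (C ` {..J}) < cmod (B m j)\<close> by linarith
    qed
    moreover have "cmod (B m j') \<le> 3 / 2 * cmod (B m j)" for j'
      using le[of j'] j by linarith
    ultimately show ?thesis
      by blast
  qed
  \<comment> \<open>A pair \<open>p\<close> consists of a row and the position of its peak.\<close>
  define P where "P i p \<longleftrightarrow> 4 ^ i \<le> cmod (B (fst p) (snd p)) \<and>
      (\<forall>j. cmod (B (fst p) j) \<le> 3 / 2 * cmod (B (fst p) (snd p)))" for i p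
  have "\<exists>p. \<forall>n. P n (p n) \<and> snd (p n) < snd (p (Suc n))"
  proof (rule dependent_nat_choice)
    have ex: "\<exists>q. P i q \<and> J < snd q" for i J
    proof -
      obtain m j where "J < j" "4 ^ i \<le> cmod (B m j)" "\<forall>j'. cmod (B m j') \<le> 3 / 2 * cmod (B m j)"
        using step by blast
      then show ?thesis
        by (intro exI[of _ "(m, j)"]) (simp add: P_def)
    qed
    show "\<exists>q. P 0 q"
      using ex by blast
    show "\<exists>q. P (Suc n) q \<and> snd p < snd q" for p n
      by (rule ex)
  qed
  then obtain p where p: "\<And>n. P n (p n)" "\<And>n. snd (p n) < snd (p (Suc n))"
    by blast
  have "\<exists>y\<in>l1_space. \<forall>i. (4 / 3) ^ i / 4 \<le> cmod (\<Sum>j. B (fst (p i)) j * y j)"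
  proof (rule l1_gliding_hump[where J = "\<lambda>i. snd (p i)"])
    show "strict_mono (\<lambda>i. snd (p i))"
      by (simp add: strict_mono_Suc_iff p(2))
  qed (use p(1) in \<open>simp_all add: P_def\<close>)
  then obtain y where y: "y \<in> l1_space" "\<And>i. (4 / 3) ^ i / 4 \<le> cmod (\<Sum>j. B (fst (p i)) j * y j)"
    by blast
  obtain K where K: "\<And>m. cmod (\<Sum>j. B m j * y j) \<le> K"
    using pt[OF y(1)] by (auto simp: bdd_above_def)
  obtain i where "4 * K < (4 / 3) ^ i"
    using real_arch_pow[of "4/3" "4 * K"] by auto
  then show False
    using y(2)[of i] K[of "fst (p i)"] by linarith
qed

section \<open>Rows acting on convolutions\<close>

lemma summable_bounded_mult_l1:
  assumes "\<And>j. cmod (b j) \<le> M" and "y \<in> l1_space"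
  shows "summable (\<lambda>j. cmod (b j * y j))"
proof (rule summable_comparison_test')
  show "summable (\<lambda>j. M * cmod (y j))"
    using assms(2) by (intro summable_mult) (simp add: l1_space_def)
  show "norm (cmod (b j * y j)) \<le> M * cmod (y j)" for j
    by (simp add: norm_mult mult_right_mono assms(1))
qed

lemma norm_suminf_bounded_mult_l1:
  assumes "\<And>j. cmod (b j) \<le> M" and "y \<in> l1_space"
  shows "cmod (\<Sum>j. b j * y j) \<le> M * l1_norm y"
proof -
  have y: "summable (\<lambda>j. cmod (y j))"
    using assms(2) by (simp add: l1_space_def)
  have "cmod (\<Sum>j. b j * y j) \<le> (\<Sum>j. cmod (b j * y j))"
    by (intro summable_norm summable_bounded_mult_l1[OF assms])
  also have "\<dots> \<le> (\<Sum>j. M * cmod (y j))"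
    by (intro suminf_le summable_bounded_mult_l1[OF assms] summable_mult y)
       (simp add: norm_mult mult_right_mono assms(1))
  also have "\<dots> = M * l1_norm y"
    by (simp add: l1_norm_def suminf_mult y)
  finally show ?thesis .
qed

text \<open>Both sides sum \<open>g i * a (i + j) * y j\<close> over the triangle
  \<open>i + j < m\<close>.\<close>

lemma sum_mult_convolution:
  fixes a g y :: "nat \<Rightarrow> complex"
  shows "(\<Sum>k<m. a k * (\<Sum>i\<le>k. g i * y (k - i))) = (\<Sum>j<m. (\<Sum>i<m - j. g i * a (j + i)) * y j)"
proof -
  have "(\<Sum>k<m. a k * (\<Sum>i\<le>k. g i * y (k - i))) =
      (\<Sum>k<m. \<Sum>i\<le>k. a (i + (k - i)) * (g i * y (k - i)))"
    by (simp add: sum_distrib_left)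
  also have "\<dots> = (\<Sum>(i, j)\<in>{(i, j). i + j < m}. a (i + j) * (g i * y j))"
    by (rule sum.triangle_reindex[symmetric, of "\<lambda>i j. a (i + j) * (g i * y j)"])
  also have "\<dots> = (\<Sum>(j, i)\<in>(SIGMA j:{..<m}. {..<m - j}). g i * a (j + i) * y j)"
    by (rule sum.reindex_bij_witness[of _ "\<lambda>(j, i). (i, j)" "\<lambda>(i, j). (j, i)"])
       (auto simp: ac_simps)
  also have "\<dots> = (\<Sum>j<m. (\<Sum>i<m - j. g i * a (j + i)) * y j)"
    by (simp add: sum.Sigma[symmetric] sum_distrib_right)
  finally show ?thesis .
qed

text \<open>The partial sums of the series are finitely supported rows \<open>B m\<close> applied to
  \<open>y\<close>. Their convergence makes them pointwise bounded, so uniform boundedness gives a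
  common bound \<open>M\<close> for all entries. It passes to the entrywise limit \<open>b\<close>,
  and \<open>M * cmod (y j)\<close> is the dominating sequence that lets Tannery's theorem exchange
  limit and sum.\<close>

lemma row_transform:
  fixes a g :: "nat \<Rightarrow> complex"
  defines "b \<equiv> \<lambda>k. \<Sum>i. g i * a (k + i)"
  assumes conv: "\<And>y. y \<in> l1_space \<Longrightarrow> summable (\<lambda>k. a k * (\<Sum>i\<le>k. g i * y (k - i)))"
  shows "bdd_above (range (\<lambda>k. cmod (b k)))"
    and "y \<in> l1_space \<Longrightarrow> (\<Sum>k. a k * (\<Sum>i\<le>k. g i * y (k - i))) = (\<Sum>k. b k * y k)"
proof -
  \<comment> \<open>At the unit vector for \<open>k\<close>, the convergent series is that of
    \<open>b k\<close> preceded by \<open>k\<close> zeros.\<close>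
  have summable_b: "summable (\<lambda>i. g i * a (k + i))" for k
  proof -
    have "(\<Sum>i\<le>k'. g i * (if k' - i = k then 1 else 0)) = (if k \<le> k' then g (k' - k) else 0)" for k'
    proof (cases "k \<le> k'")
      case True
      have "(\<Sum>i\<le>k'. g i * (if k' - i = k then 1 else 0)) = (\<Sum>i\<in>{k' - k}. g i)"
        using True by (intro sum.mono_neutral_cong_right) auto
      then show ?thesis
        using True by simp
    qed (auto intro!: sum.neutral)
    then have "summable (\<lambda>k'. a k' * (if k \<le> k' then g (k' - k) else 0))"
      using conv[OF unit_in_l1, of k] by simp
    then have "summable (\<lambda>i. a (i + k) * (if k \<le> i + k then g (i + k - k) else 0))"
      by (rule summable_ignore_initial_segment)
    then show ?thesis
      by (simp add: ac_simps)
  qed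
  define B where "B m j = (\<Sum>i<m - j. g i * a (j + i))" for m j
  have B0: "B m j = 0" if "m \<le> j" for m j
    using that by (simp add: B_def)
  have partial: "(\<Sum>k<m. a k * (\<Sum>i\<le>k. g i * y (k - i))) = (\<Sum>j. B m j * y j)" for m y
    unfolding sum_mult_convolution B_def[symmetric]
    by (rule suminf_finite[symmetric]) (auto simp: B0)
  have "\<exists>M. \<forall>m j. cmod (B m j) \<le> M"
  proof (rule l1_uniform_boundedness)
    fix m
    have "cmod (B m j) \<le> (\<Sum>l<m. cmod (B m l))" for j
      by (cases "j < m") (auto intro: member_le_sum simp: B0 sum_nonneg)
    then show "bdd_above (range (\<lambda>j. cmod (B m j)))"
      by (intro bdd_aboveI2)
  next
    fix y assume "y \<in> l1_space"
    then have "convergent (\<lambda>m. \<Sum>j. B m j * y j)"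
      using conv unfolding partial[symmetric] by (simp flip: summable_iff_convergent)
    then show "bdd_above (range (\<lambda>m. cmod (\<Sum>j. B m j * y j)))"
      by (rule convergent_bdd_above_cmod)
  qed
  then obtain M where M: "\<And>m j. cmod (B m j) \<le> M"
    by blast
  have lim: "(\<lambda>m. B m j) \<longlonglongrightarrow> b j" for j
  proof -
    \<comment> \<open>After the shift by \<open>j\<close> the sum defining \<open>B\<close> runs
      over \<open>i < m\<close>, so it is a partial sum of \<open>b j\<close>.\<close>
    have "(\<lambda>m. B (m + j) j) \<longlonglongrightarrow> b j"
      unfolding B_def b_def using summable_LIMSEQ[OF summable_b, of j] by simp
    then show ?thesis
      by (rule LIMSEQ_offset)
  qed
  have bM: "cmod (b j) \<le> M" for j
    by (rule LIMSEQ_le_const2[OF tendsto_norm[OF lim]]) (use M in blast)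
  then show "bdd_above (range (\<lambda>k. cmod (b k)))"
    by (auto simp: bdd_above_def)
  show "(\<Sum>k. a k * (\<Sum>i\<le>k. g i * y (k - i))) = (\<Sum>k. b k * y k)" if y: "y \<in> l1_space"
  proof -
    have "(\<lambda>m. \<Sum>j. B m j * y j) \<longlonglongrightarrow> (\<Sum>j. b j * y j)"
    proof (rule tannerys_theorem[THEN conjunct2, THEN conjunct2])
      show "summable (\<lambda>j. M * cmod (y j))"
        using y by (intro summable_mult) (simp add: l1_space_def)
      show "\<forall>\<^sub>F (j, m) in sequentially \<times>\<^sub>F sequentially. norm (B m j * y j) \<le> M * cmod (y j)"
        by (intro always_eventually) (auto simp: norm_mult M mult_right_mono)
    qed (simp_all add: tendsto_mult_right lim)
    then have "(\<lambda>k. a k * (\<Sum>i\<le>k. g i * y (k - i))) sums (\<Sum>k. b k * y k)"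
      by (simp add: sums_def partial)
    then show ?thesis
      by (rule sums_unique[symmetric])
  qed
qed

section \<open>The fractional difference as multiplication by a formal power series\<close>

lemma frac_coeff_gbinomial:
  assumes "\<alpha> \<notin> \<int>"
  shows "frac_coeff \<alpha> i = (-1) ^ i * (\<alpha> gchoose i)"
proof -
  have "\<alpha> + 1 \<notin> \<int>"
    using assms Ints_diff[of "\<alpha> + 1" 1] by auto
  then have "\<alpha> + 1 \<notin> \<int>\<^sub>\<le>\<^sub>0"
    using nonpos_Ints_subset_Ints by blast
  then show ?thesis
    by (simp add: frac_coeff_def gbinomial_Gamma)
qed

text \<open>For non-integer \<alpha> this is the binomial series of \<open>(1 - X)^\<alpha>\<close>.
  As a formal series it makes composition of differences associative without any question of
  convergence.\<close>

definition frac_fps :: "real \<Rightarrow> complex fps" where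
  "frac_fps \<alpha> = Abs_fps (\<lambda>i. complex_of_real (frac_coeff \<alpha> i))"

lemma frac_diff_eq_fps_nth: "frac_diff \<alpha> x = fps_nth (frac_fps \<alpha> * Abs_fps x)"
  by (simp add: fun_eq_iff frac_diff_def fps_mult_nth frac_fps_def atLeast0AtMost)

text \<open>By Vandermonde's convolution the coefficients of the product are, up to sign, the
  binomials \<open>0 gchoose n\<close>.\<close>

lemma frac_fps_inverse:
  assumes "\<alpha> \<notin> \<int>"
  shows "frac_fps (-\<alpha>) * frac_fps \<alpha> = 1"
proof (rule fps_ext)
  fix n
  have m: "-\<alpha> \<notin> \<int>"
    using assms by simp
  have "fps_nth (frac_fps (-\<alpha>) * frac_fps \<alpha>) n =
      of_real (\<Sum>i\<in>{0..n}. frac_coeff (-\<alpha>) i * frac_coeff \<alpha> (n - i))"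
    by (simp add: fps_mult_nth frac_fps_def)
  also have "(\<Sum>i\<in>{0..n}. frac_coeff (-\<alpha>) i * frac_coeff \<alpha> (n - i)) =
      (\<Sum>i\<in>{0..n}. (-1) ^ n * ((-\<alpha> gchoose i) * (\<alpha> gchoose (n - i))))"
    by (intro sum.cong)
       (auto simp: frac_coeff_gbinomial[OF assms] frac_coeff_gbinomial[OF m] simp flip: power_add)
  also have "\<dots> = (-1) ^ n * ((0::real) gchoose n)"
    using gbinomial_Vandermonde[of "-\<alpha>" \<alpha> n] by (simp flip: sum_distrib_left add: atLeast0AtMost)
  also have "\<dots> = (if n = 0 then 1 else 0)"
    by (cases n) auto
  finally show "fps_nth (frac_fps (-\<alpha>) * frac_fps \<alpha>) n = fps_nth 1 n"
    by simp
qed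

lemma frac_diff_inverse:
  assumes "\<alpha> \<notin> \<int>"
  shows "frac_diff (-\<alpha>) (frac_diff \<alpha> x) = x"
  by (simp add: frac_diff_eq_fps_nth fps_nth_inverse mult.assoc[symmetric] frac_fps_inverse[OF assms] fun_eq_iff)

text \<open>The preimage is the difference of order \<open>-\<alpha>\<close> of \<open>y\<close>, by
  the inversion formula with the two orders exchanged.\<close>

lemma frac_diff_surj:
  assumes "\<alpha> \<notin> \<int>" and "y \<in> l1_space"
  obtains x where "x \<in> l1_frac_space \<alpha>" "frac_diff \<alpha> x = y"
  using frac_diff_inverse[of "-\<alpha>" y] assms that[of "frac_diff (-\<alpha>) y"]
  by (simp add: l1_frac_space_def)

section \<open>The associated matrix\<close>

lemma
  assumes \<alpha>: "\<alpha> \<notin> \<int>" and A: "A \<in> matrix_class (l1_frac_space \<alpha>) Y"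
  shows bdd_above_assoc_matrix_row: "bdd_above (range (\<lambda>k. cmod (assoc_matrix \<alpha> A n k)))"
    and mat_apply_eq_assoc_matrix: "x \<in> l1_frac_space \<alpha> \<Longrightarrow>
      mat_apply A x n = (\<Sum>k. assoc_matrix \<alpha> A n k * frac_diff \<alpha> x k)"
proof -
  let ?g = "\<lambda>i. complex_of_real (frac_coeff (-\<alpha>) i)"
  \<comment> \<open>Substituting \<open>x = frac_diff (-\<alpha>) y\<close> turns convergence on the
    fractional space into the hypothesis of \<open>row_transform\<close>.\<close>
  have conv: "summable (\<lambda>k. A n k * (\<Sum>i\<le>k. ?g i * y (k - i)))" if "y \<in> l1_space" for y
  proof -
    obtain x where "x \<in> l1_frac_space \<alpha>" "frac_diff \<alpha> x = y"
      using frac_diff_surj[OF \<alpha>] \<open>y \<in> l1_space\<close> by blast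
    then show ?thesis
      using A frac_diff_inverse[OF \<alpha>, of x]
      by (auto simp: matrix_class_def frac_diff_def[of "-\<alpha>", abs_def] fun_eq_iff)
  qed
  show "bdd_above (range (\<lambda>k. cmod (assoc_matrix \<alpha> A n k)))"
    unfolding assoc_matrix_def by (rule row_transform(1)[OF conv])
  show "mat_apply A x n = (\<Sum>k. assoc_matrix \<alpha> A n k * frac_diff \<alpha> x k)"
    if "x \<in> l1_frac_space \<alpha>"
  proof -
    have "(\<Sum>i\<le>k. ?g i * frac_diff \<alpha> x (k - i)) = x k" for k
      using frac_diff_inverse[OF \<alpha>, of x] by (simp add: frac_diff_def[of "-\<alpha>"] fun_eq_iff)
    then show ?thesis
      using row_transform(2)[OF conv, of "frac_diff \<alpha> x"] that
      by (simp add: l1_frac_space_def mat_apply_def assoc_matrix_def)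
  qed
qed

text \<open>This is uniform boundedness applied to all rows at once: the images are convergent
  sequences, hence bounded in \<open>n\<close>.\<close>

lemma assoc_matrix_bounded:
  assumes \<alpha>: "\<alpha> \<notin> \<int>" and A: "A \<in> matrix_class (l1_frac_space \<alpha>) Y" and Y: "Y \<subseteq> c_space"
  obtains M where "\<And>n k. cmod (assoc_matrix \<alpha> A n k) \<le> M"
proof -
  have "\<exists>M. \<forall>n k. cmod (assoc_matrix \<alpha> A n k) \<le> M"
  proof (rule l1_uniform_boundedness)
    show "bdd_above (range (\<lambda>k. cmod (assoc_matrix \<alpha> A n k)))" for n
      by (rule bdd_above_assoc_matrix_row[OF \<alpha> A])
  next
    fix y assume "y \<in> l1_space"
    then obtain x where x: "x \<in> l1_frac_space \<alpha>" "frac_diff \<alpha> x = y"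
      using frac_diff_surj[OF \<alpha>] by blast
    have "mat_apply A x \<in> c_space"
      using A Y x(1) by (auto simp: matrix_class_def)
    then have "bdd_above (range (\<lambda>n. cmod (mat_apply A x n)))"
      by (intro convergent_bdd_above_cmod) (simp add: c_space_def)
    then show "bdd_above (range (\<lambda>n. cmod (\<Sum>k. assoc_matrix \<alpha> A n k * y k)))"
      using mat_apply_eq_assoc_matrix[OF \<alpha> A x(1)] x(2) by simp
  qed
  then show thesis
    using that by blast
qed

section \<open>Limits of tail suprema\<close>

text \<open>The tail suprema decrease within \<open>[0, M]\<close>, so they converge to a finite
  infimum. The last two conclusions describe \<open>l\<close> as the infimum of the eventual uniform
  bounds; one serves the upper estimate of the operator, the other the lower.\<close>

lemma tail_SUP_tendsto:
  fixes D :: "nat \<Rightarrow> nat \<Rightarrow> real"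
  assumes nonneg: "\<And>n k. 0 \<le> D n k" and bounded: "\<And>n k. D n k \<le> M"
  obtains l where "(\<lambda>r. SUP n\<in>{r..}. SUP k. ereal (D n k)) \<longlonglongrightarrow> ereal l" "0 \<le> l"
    "\<And>c. l < c \<Longrightarrow> \<exists>r. \<forall>n\<ge>r. \<forall>k. D n k \<le> c"
    "\<forall>c r. (\<forall>n\<ge>r. \<forall>k. D n k \<le> c) \<longrightarrow> l \<le> c"
proof -
  define F where "F r = (SUP n\<in>{r..}. SUP k. ereal (D n k))" for r
  have le: "ereal (D n k) \<le> F r" if "r \<le> n" for r n k
    unfolding F_def using that by (intro SUP_upper2[of n] SUP_upper) auto
  have least: "F r \<le> ereal c" if "\<And>n k. r \<le> n \<Longrightarrow> D n k \<le> c" for r c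
    unfolding F_def using that by (intro SUP_least) auto
  have "decseq F"
    unfolding F_def by (intro antimonoI SUP_subset_mono) auto
  then have lim: "F \<longlonglongrightarrow> (INF r. F r)"
    by (rule LIMSEQ_INF)
  have "0 \<le> F r" for r
    by (rule order_trans[OF _ le[of r r 0]]) (simp_all add: nonneg)
  then have "0 \<le> (INF r. F r)"
    by (intro INF_greatest)
  moreover have "(INF r. F r) \<le> ereal M"
    by (rule INF_lower2[of 0]) (auto intro: least bounded)
  ultimately obtain l where l: "(INF r. F r) = ereal l" "0 \<le> l"
    by (cases "INF r. F r") auto
  show thesis
  proof
    show "(\<lambda>r. SUP n\<in>{r..}. SUP k. ereal (D n k)) \<longlonglongrightarrow> ereal l"
      using lim unfolding F_def[symmetric] l(1) .
    show "0 \<le> l"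
      by (rule l(2))
    show "\<exists>r. \<forall>n\<ge>r. \<forall>k. D n k \<le> c" if "l < c" for c
    proof -
      have "(INF r. F r) < ereal c"
        using l that by simp
      then obtain r where "F r < ereal c"
        by (auto simp: INF_less_iff)
      then have "D n k \<le> c" if "r \<le> n" for n k
        using order_le_less_trans[OF le[OF that, of k] \<open>F r < ereal c\<close>] by simp
      then show ?thesis
        by blast
    qed
    have "ereal l \<le> ereal c" if "\<forall>n\<ge>r. \<forall>k. D n k \<le> c" for c r
      unfolding l(1)[symmetric] using that by (intro INF_lower2[of r] least) auto
    then show "\<forall>c r. (\<forall>n\<ge>r. \<forall>k. D n k \<le> c) \<longrightarrow> l \<le> c"
      by auto
  qed
qed

section \<open>Estimating the Hausdorff measure by finite covers\<close>

definition finite_ball_cover :: "'a set \<Rightarrow> ('a \<Rightarrow> 'a \<Rightarrow> real) \<Rightarrow> 'a set \<Rightarrow> real \<Rightarrow> bool" where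
  "finite_ball_cover M d Q \<epsilon> \<longleftrightarrow> 0 < \<epsilon> \<and>
     (\<exists>F. finite F \<and> F \<subseteq> M \<times> {0<..<\<epsilon>} \<and> Q \<subseteq> (\<Union>(x, r)\<in>F. Metric_space.mball M d x r))"

lemma hausdorff_mnc_le:
  assumes "finite_ball_cover M d Q \<epsilon>"
  shows "hausdorff_mnc M d Q \<le> \<epsilon>"
  unfolding hausdorff_mnc_def finite_ball_cover_def[symmetric]
  by (rule cInf_lower) (use assms in \<open>auto simp: finite_ball_cover_def intro!: bdd_belowI[of _ 0]\<close>)

text \<open>One cover has to be exhibited, since the infimum of an empty set of reals carries no
  information.\<close>

lemma le_hausdorff_mnc:
  assumes "finite_ball_cover M d Q \<epsilon>" "\<And>\<epsilon>. finite_ball_cover M d Q \<epsilon> \<Longrightarrow> c \<le> \<epsilon>"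
  shows "c \<le> hausdorff_mnc M d Q"
  unfolding hausdorff_mnc_def finite_ball_cover_def[symmetric]
  by (rule cInf_greatest) (use assms in auto)

context Metric_space
begin

lemma finite_ball_coverI:
  assumes "finite Z" "Z \<subseteq> M" "Q \<subseteq> M" "0 \<le> \<rho>" "\<rho> < \<epsilon>" "\<And>q. q \<in> Q \<Longrightarrow> \<exists>z\<in>Z. d z q \<le> \<rho>"
  shows "finite_ball_cover M d Q \<epsilon>"
  unfolding finite_ball_cover_def
proof (intro conjI exI)
  \<comment> \<open>The midpoint of \<open>\<rho>\<close> and \<open>\<epsilon>\<close> is a radius
    whose open balls contain the closed \<open>\<rho>\<close>-balls and which is still below
    \<open>\<epsilon>\<close>.\<close>
  show "Q \<subseteq> (\<Union>(x, r)\<in>Z \<times> {(\<rho> + \<epsilon>) / 2}. mball x r)"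
  proof
    fix q assume q: "q \<in> Q"
    then obtain z where "z \<in> Z" "d z q \<le> \<rho>"
      using assms(6) by blast
    with q assms show "q \<in> (\<Union>(x, r)\<in>Z \<times> {(\<rho> + \<epsilon>) / 2}. mball x r)"
      by (intro UN_I[of "(z, (\<rho> + \<epsilon>) / 2)"]) auto
  qed
qed (use assms in auto)

lemma finite_ball_coverE:
  assumes "finite_ball_cover M d Q \<epsilon>"
  obtains Z where "0 < \<epsilon>" "finite Z" "Z \<subseteq> M" "Q \<subseteq> M" "\<And>q. q \<in> Q \<Longrightarrow> \<exists>z\<in>Z. d z q < \<epsilon>"
proof -
  obtain F where F: "0 < \<epsilon>" "finite F" "F \<subseteq> M \<times> {0<..<\<epsilon>}" "Q \<subseteq> (\<Union>(x, r)\<in>F. mball x r)"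
    using assms unfolding finite_ball_cover_def by blast
  show thesis
  proof (rule that[of "fst ` F"])
    fix q assume "q \<in> Q"
    then obtain x r where "(x, r) \<in> F" "q \<in> mball x r"
      using F(4) by blast
    with F(3) show "\<exists>z\<in>fst ` F. d z q < \<epsilon>"
      by force
  qed (use F in force)+
qed

lemma mbounded_imp_finite_ball_cover:
  assumes "mbounded Q"
  obtains \<epsilon> where "finite_ball_cover M d Q \<epsilon>"
proof -
  obtain x B where B: "0 < B" "Q \<subseteq> mcball x B"
    using assms by (auto simp: mbounded_pos)
  show thesis
  proof (rule that, rule finite_ball_coverI)
    \<comment> \<open>The point \<open>x\<close> may lie outside \<open>M\<close>; then its ball,
      and with it \<open>Q\<close>, is empty, and the empty set of centres works.\<close>
    show "finite ({x} \<inter> M)" "{x} \<inter> M \<subseteq> M" "Q \<subseteq> M" "0 \<le> B" "B < B + 1"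
      using B mcball_subset_mspace[of x B] by auto
    show "\<exists>z\<in>{x} \<inter> M. d z q \<le> B" if "q \<in> Q" for q
      using that B(2) by auto
  qed
qed

end

section \<open>Null and convergent sequences as one family of spaces\<close>

definition lim_space :: "complex set \<Rightarrow> cseq set" where
  "lim_space K = {x. \<exists>l\<in>K. x \<longlonglongrightarrow> l}"

lemma c0_space_eq_lim_space: "c0_space = lim_space {0}"
  by (simp add: c0_space_def lim_space_def)

lemma c_space_eq_lim_space: "c_space = lim_space UNIV"
  by (simp add: c_space_def lim_space_def convergent_def)

lemma l1_space_diff: "x \<in> l1_space \<Longrightarrow> y \<in> l1_space \<Longrightarrow> (\<lambda>k. x k - y k) \<in> l1_space"
  unfolding l1_space_def mem_Collect_eq
  by (rule summable_comparison_test'[OF summable_add[of "\<lambda>k. cmod (x k)" "\<lambda>k. cmod (y k)"], of 0])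
     (simp_all add: norm_triangle_ineq4)

lemma frac_diff_diff: "frac_diff \<alpha> (\<lambda>k. x k - y k) = (\<lambda>k. frac_diff \<alpha> x k - frac_diff \<alpha> y k)"
  by (simp add: frac_diff_def algebra_simps sum_subtractf)

lemma l1_norm_unit: "l1_norm (\<lambda>j. if j = k then 1 else 0) = 1"
  unfolding l1_norm_def by (subst suminf_finite[of "{k}"]) auto

lemma assoc_matrix_column:
  assumes \<alpha>: "\<alpha> \<notin> \<int>" and A: "A \<in> matrix_class (l1_frac_space \<alpha>) Y"
    and x: "x \<in> l1_frac_space \<alpha>" "frac_diff \<alpha> x = (\<lambda>j. if j = k then 1 else 0)"
  shows "mat_apply A x = (\<lambda>n. assoc_matrix \<alpha> A n k)"
proof
  show "mat_apply A x n = assoc_matrix \<alpha> A n k" for n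
    unfolding mat_apply_eq_assoc_matrix[OF \<alpha> A x(1)] x(2)
    by (subst suminf_finite[of "{k}"]) auto
qed

lemma assoc_matrix_column_in:
  assumes \<alpha>: "\<alpha> \<notin> \<int>" and A: "A \<in> matrix_class (l1_frac_space \<alpha>) Y"
  shows "(\<lambda>n. assoc_matrix \<alpha> A n k) \<in> Y"
proof -
  obtain x where x: "x \<in> l1_frac_space \<alpha>" "frac_diff \<alpha> x = (\<lambda>j. if j = k then 1 else 0)"
    by (rule frac_diff_surj[OF \<alpha> unit_in_l1])
  then show ?thesis
    using A unfolding assoc_matrix_column[OF \<alpha> A x, symmetric] by (simp add: matrix_class_def)
qed

text \<open>The net has to lie in \<open>K\<close> because its points become limits of correction
  sequences, which for \<open>K = {0}\<close> must be null sequences.\<close>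

lemma finite_net_in_cball:
  fixes K :: "complex set"
  assumes "closed K" "0 < \<delta>"
  obtains G where "finite G" "G \<subseteq> K" "\<And>x. x \<in> K \<Longrightarrow> cmod x \<le> R \<Longrightarrow> \<exists>g\<in>G. cmod (x - g) < \<delta>"
proof -
  have "compact (cball 0 R \<inter> K)"
    using assms(1) by (intro compact_Int_closed compact_cball)
  then have "\<exists>G. finite G \<and> G \<subseteq> cball 0 R \<inter> K \<and> cball 0 R \<inter> K \<subseteq> (\<Union>x\<in>G. ball x \<delta>)"
    using \<open>0 < \<delta>\<close> by (intro seq_compact_imp_totally_bounded[rule_format] compact_imp_seq_compact)
  then obtain G where G: "finite G" "G \<subseteq> cball 0 R \<inter> K" "cball 0 R \<inter> K \<subseteq> (\<Union>x\<in>G. ball x \<delta>)"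
    by blast
  show thesis
  proof (rule that[OF G(1)])
    show "\<exists>g\<in>G. cmod (x - g) < \<delta>" if "x \<in> K" "cmod x \<le> R" for x
    proof -
      have "x \<in> cball 0 R \<inter> K"
        using that by simp
      then obtain g where "g \<in> G" "x \<in> ball g \<delta>"
        using G(3) by blast
      then show ?thesis
        by (auto simp: dist_norm norm_minus_commute)
    qed
  qed (use G(2) in blast)
qed

section \<open>Two-sided estimate of the measure of noncompactness\<close>

locale matrix_into_lim_space =
  fixes \<alpha> :: real and A :: "nat \<Rightarrow> nat \<Rightarrow> complex" and K :: "complex set"
    and \<beta> :: "nat \<Rightarrow> complex" and M :: real
  assumes \<alpha>: "\<alpha> \<notin> \<int>"
    and K: "K = {0} \<or> K = UNIV"
    and A: "A \<in> matrix_class (l1_frac_space \<alpha>) (lim_space K)"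
    and M: "\<And>n k. cmod (assoc_matrix \<alpha> A n k) \<le> M"
    and \<beta>: "\<And>k. (\<lambda>n. assoc_matrix \<alpha> A n k) \<longlonglongrightarrow> \<beta> k"
begin

abbreviation "a \<equiv> assoc_matrix \<alpha> A"
abbreviation "X \<equiv> l1_frac_space \<alpha>"
abbreviation "d \<equiv> l1_frac_metric \<alpha>"
abbreviation "Y \<equiv> lim_space K"
abbreviation "e \<equiv> norm_metric Y sup_norm"

sublocale X: Metric_space X d
  by (rule Metric_space_l1_frac[OF \<alpha>])

sublocale Y: Metric_space Y e
  using K Metric_space_c0 Metric_space_c
  by (auto simp: c0_space_eq_lim_space c_space_eq_lim_space)

lemma bdd_above_Y: "x \<in> Y \<Longrightarrow> y \<in> Y \<Longrightarrow> bdd_above (range (\<lambda>n. cmod (x n - y n)))"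
  by (rule convergent_bdd_above_cmod) (auto simp: lim_space_def convergent_def intro: tendsto_diff)

lemma norm_diff_le_dist: "x \<in> Y \<Longrightarrow> y \<in> Y \<Longrightarrow> cmod (x n - y n) \<le> e x y"
  unfolding norm_metric_def sup_norm_def using cSUP_upper[OF UNIV_I bdd_above_Y, of x y n] by simp

lemma dist_leI: "x \<in> Y \<Longrightarrow> y \<in> Y \<Longrightarrow> (\<And>n. cmod (x n - y n) \<le> \<rho>) \<Longrightarrow> e x y \<le> \<rho>"
  unfolding norm_metric_def sup_norm_def by (simp add: cSUP_least)

lemma mat_apply_in: "x \<in> X \<Longrightarrow> mat_apply A x \<in> Y"
  using A by (simp add: matrix_class_def)

lemma M_nonneg: "0 \<le> M"
  using M[of 0 0] norm_ge_zero order_trans by blast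

lemma norm_\<beta>_le: "cmod (\<beta> k) \<le> M"
  by (rule LIMSEQ_le_const2[OF tendsto_norm[OF \<beta>]]) (use M in blast)

lemma \<beta>_eq_0: "\<beta> k = 0" if "K = {0}"
  using assoc_matrix_column_in[OF \<alpha> A, of k] LIMSEQ_unique[OF \<beta>] that by (auto simp: lim_space_def)

text \<open>For \<open>K = {0}\<close> the columns are null sequences, so all
  \<open>\<beta> k\<close> vanish; this puts the sum within reach of a net inside
  \<open>K\<close>.\<close>

lemma suminf_\<beta>_in: "(\<Sum>k. \<beta> k * h k) \<in> K"
  using K \<beta>_eq_0 by auto

lemma mat_apply_diff:
  assumes "x \<in> X" "z \<in> X"
  obtains h where "h \<in> l1_space" "l1_norm h = d z x"
    "\<And>n. mat_apply A z n - mat_apply A x n = (\<Sum>k. a n k * h k)"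
proof
  let ?h = "\<lambda>k. frac_diff \<alpha> z k - frac_diff \<alpha> x k"
  have l1: "frac_diff \<alpha> z \<in> l1_space" "frac_diff \<alpha> x \<in> l1_space"
    using assms by (simp_all add: l1_frac_space_def)
  then show "?h \<in> l1_space"
    by (rule l1_space_diff)
  show "l1_norm ?h = d z x"
    using assms by (simp add: norm_metric_def l1_frac_norm_def frac_diff_diff)
  show "mat_apply A z n - mat_apply A x n = (\<Sum>k. a n k * ?h k)" for n
    using suminf_diff[OF summable_norm_cancel summable_norm_cancel,
        OF summable_bounded_mult_l1[of "a n", OF M l1(1)] summable_bounded_mult_l1[of "a n", OF M l1(2)]]
    by (simp add: mat_apply_eq_assoc_matrix[OF \<alpha> A] assms right_diff_distrib)
qed

text \<open>For \<open>x\<close> within \<open>q\<close> of a centre \<open>z\<close>, \<open>A x - A z\<close> is, up to an error of at most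
  \<open>c q\<close> in the coordinates \<open>n \<ge> r\<close>, determined by its first \<open>r\<close> coordinates and the number
  \<open>\<Sum>k. \<beta> k * h k\<close> with \<open>h = \<Delta> (x - z)\<close>, all of which range over a totally bounded
  subset of the plane.\<close>

lemma finite_ball_cover_image:
  assumes cover: "finite_ball_cover X d Q q" and c: "\<And>n k. r \<le> n \<Longrightarrow> cmod (a n k - \<beta> k) \<le> c"
    and \<delta>: "0 < \<delta>"
  shows "finite_ball_cover Y e (mat_apply A ` Q) (c * q + 2 * \<delta>)"
proof -
  obtain Z where Z: "0 < q" "finite Z" "Z \<subseteq> X" "Q \<subseteq> X" "\<And>x. x \<in> Q \<Longrightarrow> \<exists>z\<in>Z. d z x < q"
    using X.finite_ball_coverE[OF cover] by blast
  have c0: "0 \<le> c"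
    using c[of r 0] norm_ge_zero order_trans by blast
  \<comment> \<open>The sums to be approximated have norm at most \<open>M * q\<close>, because
    \<open>h\<close> has norm below \<open>q\<close>.\<close>
  obtain G where G: "finite G" "\<And>x. cmod x \<le> M * q \<Longrightarrow> \<exists>g\<in>G. cmod (x - g) < \<delta>"
    by (rule finite_net_in_cball[OF closed_UNIV \<delta>, of "M * q"]) simp
  have "closed K"
    using K by auto
  then obtain G' where G': "finite G'" "G' \<subseteq> K"
    "\<And>x. x \<in> K \<Longrightarrow> cmod x \<le> M * q \<Longrightarrow> \<exists>g\<in>G'. cmod (x - g) < \<delta>"
    by (rule finite_net_in_cball[OF _ \<delta>, of K "M * q"]) blast
  \<comment> \<open>A correction sequence has free values in the first \<open>r\<close> coordinates
    and is constantly \<open>w\<close> afterwards, so \<open>w\<close> is its limit.\<close>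
  define step where "step f w n = (if n < r then f n else w)"
    for f :: "nat \<Rightarrow> complex" and w :: complex and n :: nat
  have step_lim: "step f w \<longlonglongrightarrow> w" for f w
    by (rule tendsto_eventually) (auto simp: step_def eventually_sequentially intro!: exI[of _ r])
  \<comment> \<open>Only the values of \<open>f\<close> below \<open>r\<close> enter, so extensional
    functions on \<open>{..<r}\<close> are enough and \<open>W\<close> is finite.\<close>
  define W where "W = (\<lambda>(z, f, w) n. mat_apply A z n - step f w n) ` (Z \<times> ({..<r} \<rightarrow>\<^sub>E G) \<times> G')"
  show ?thesis
  proof (rule Y.finite_ball_coverI)
    show "finite W"
      unfolding W_def using Z(2) G(1) G'(1) by (intro finite_imageI finite_cartesian_product finite_PiE) auto
    show W: "W \<subseteq> Y"
    proof
      fix y assume "y \<in> W"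
      then obtain z f w where y: "y = (\<lambda>n. mat_apply A z n - step f w n)" "z \<in> Z" "w \<in> G'"
        by (auto simp: W_def)
      obtain m where m: "m \<in> K" "mat_apply A z \<longlonglongrightarrow> m"
        using mat_apply_in[of z] y(2) Z(3) by (auto simp: lim_space_def)
      then have "y \<longlonglongrightarrow> m - w"
        unfolding y(1) by (intro tendsto_diff step_lim)
      moreover have "m - w \<in> K"
        using K m(1) y(3) G'(2) by auto
      ultimately show "y \<in> Y"
        by (auto simp: lim_space_def)
    qed
    show "mat_apply A ` Q \<subseteq> Y"
      using Z(4) mat_apply_in by blast
    show "0 \<le> c * q + \<delta>" "c * q + \<delta> < c * q + 2 * \<delta>"
      using c0 Z(1) \<delta> by auto
    fix y assume "y \<in> mat_apply A ` Q"
    then obtain x where x: "x \<in> Q" "y = mat_apply A x"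
      by blast
    obtain z where z: "z \<in> Z" "d z x < q"
      using Z(5)[OF x(1)] by blast
    have xz: "x \<in> X" "z \<in> X"
      using x(1) z(1) Z by auto
    obtain h where h: "h \<in> l1_space" "l1_norm h = d z x"
      "\<And>n. mat_apply A z n - mat_apply A x n = (\<Sum>k. a n k * h k)"
      using mat_apply_diff[OF xz] by blast
    have bound: "cmod (\<Sum>k. b k * h k) \<le> C * q" if "\<And>k. cmod (b k) \<le> C" for b C
    proof -
      have "0 \<le> C"
        using that[of 0] norm_ge_zero order_trans by blast
      then have "C * l1_norm h \<le> C * q"
        using z(2) h(2) by (intro mult_left_mono) auto
      then show ?thesis
        using norm_suminf_bounded_mult_l1[of b, OF that h(1)] by linarith
    qed
    have "\<exists>f. \<forall>n. f n \<in> G \<and> cmod ((\<Sum>k. a n k * h k) - f n) < \<delta>"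
    proof (intro choice allI)
      show "\<exists>g. g \<in> G \<and> cmod ((\<Sum>k. a n k * h k) - g) < \<delta>" for n
        using G(2)[OF bound[of "a n", OF M]] by blast
    qed
    then obtain f where f: "\<And>n. f n \<in> G" "\<And>n. cmod ((\<Sum>k. a n k * h k) - f n) < \<delta>"
      by blast
    obtain w where w: "w \<in> G'" "cmod ((\<Sum>k. \<beta> k * h k) - w) < \<delta>"
      using G'(3)[OF suminf_\<beta>_in bound[OF norm_\<beta>_le]] by blast
    let ?y = "\<lambda>n. mat_apply A z n - step (restrict f {..<r}) w n"
    have y: "?y \<in> W"
      unfolding W_def using z(1) f(1) w(1)
      by (intro image_eqI[of _ _ "(z, restrict f {..<r}, w)"]) auto
    have "e ?y (mat_apply A x) \<le> c * q + \<delta>"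
    proof (rule dist_leI)
      show "?y \<in> Y" "mat_apply A x \<in> Y"
        using y W mat_apply_in xz by auto
      fix n
      have eq: "?y n - mat_apply A x n = (\<Sum>k. a n k * h k) - step (restrict f {..<r}) w n"
        using h(3)[of n] by (simp add: algebra_simps)
      show "cmod (?y n - mat_apply A x n) \<le> c * q + \<delta>"
      proof (cases "n < r")
        case True
        then have "cmod (?y n - mat_apply A x n) < \<delta>"
          using f(2)[of n] unfolding eq by (simp add: step_def)
        moreover have "0 \<le> c * q"
          using c0 Z(1) by simp
        ultimately show ?thesis
          by linarith
      next
        case False
        \<comment> \<open>From coordinate \<open>r\<close> on, \<open>w\<close> absorbs the part of
          the sum due to \<open>\<beta>\<close>, and \<open>c\<close> controls the rest.\<close>
        have "(\<Sum>k. (a n k - \<beta> k) * h k) = (\<Sum>k. a n k * h k) - (\<Sum>k. \<beta> k * h k)"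
          using suminf_diff[OF summable_norm_cancel summable_norm_cancel,
              OF summable_bounded_mult_l1[of "a n", OF M h(1)] summable_bounded_mult_l1[of \<beta>, OF norm_\<beta>_le h(1)]]
          by (simp add: left_diff_distrib)
        then have "?y n - mat_apply A x n =
            (\<Sum>k. (a n k - \<beta> k) * h k) + ((\<Sum>k. \<beta> k * h k) - w)"
          using False unfolding eq by (simp add: step_def)
        also have "cmod \<dots> \<le> c * q + \<delta>"
          using False c w(2) by (intro norm_triangle_le add_mono bound) auto
        finally show ?thesis .
      qed
    qed
    then show "\<exists>z\<in>W. e z y \<le> c * q + \<delta>"
      unfolding x(2) using y by blast
  qed
qed

lemma hausdorff_mnc_image_le:
  assumes l: "0 \<le> l" "\<And>c. l < c \<Longrightarrow> \<exists>r. \<forall>n\<ge>r. \<forall>k. cmod (a n k - \<beta> k) \<le> c"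
    and Q: "X.mbounded Q"
  shows "hausdorff_mnc Y e (mat_apply A ` Q) \<le> l * hausdorff_mnc X d Q"
proof -
  have le: "hausdorff_mnc Y e (mat_apply A ` Q) \<le> l * q" if q: "finite_ball_cover X d Q q" for q
  proof (rule field_le_epsilon)
    fix \<eta> :: real assume \<eta>: "0 < \<eta>"
    have q0: "0 < q"
      using q by (simp add: finite_ball_cover_def)
    \<comment> \<open>The slack \<open>\<eta> / (2 * q)\<close> in the constant and the choice
      \<open>\<delta> = \<eta> / 4\<close> cost \<open>\<eta> / 2\<close> each.\<close>
    with \<eta> have "l < l + \<eta> / (2 * q)"
      by simp
    then obtain r where "\<And>n k. r \<le> n \<Longrightarrow> cmod (a n k - \<beta> k) \<le> l + \<eta> / (2 * q)"
      using l(2) by blast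
    then have "hausdorff_mnc Y e (mat_apply A ` Q) \<le> (l + \<eta> / (2 * q)) * q + 2 * (\<eta> / 4)"
      using \<eta> by (intro hausdorff_mnc_le finite_ball_cover_image[OF q]) auto
    also have "\<dots> = l * q + \<eta>"
      using q0 by (simp add: field_simps)
    finally show "hausdorff_mnc Y e (mat_apply A ` Q) \<le> l * q + \<eta>" .
  qed
  obtain q where q: "finite_ball_cover X d Q q"
    using X.mbounded_imp_finite_ball_cover[OF Q] .
  show ?thesis
  \<comment> \<open>For positive \<open>l\<close> the estimate passes to the infimum over
    \<open>q\<close> after division by \<open>l\<close>; for \<open>l = 0\<close> a single cover
    suffices.\<close>
  proof (cases "l = 0")
    case True
    then show ?thesis
      using le[OF q] by simp
  next
    case False
    with l(1) have l0: "0 < l"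
      by simp
    have "hausdorff_mnc Y e (mat_apply A ` Q) / l \<le> hausdorff_mnc X d Q"
      using le l0 by (intro le_hausdorff_mnc[OF q]) (simp add: field_simps)
    then show ?thesis
      using l0 by (simp add: field_simps)
  qed
qed

text \<open>A centre of a ball containing the \<open>k\<close>-th column of \<open>a\<close> has a limit in \<open>K\<close>; for
  \<open>K = {0}\<close> this limit equals \<open>\<beta> k\<close>, otherwise it is only within \<open>\<epsilon>\<close> of it.
  This is the origin of the factor \<open>1/2\<close>.\<close>

definition "\<kappa> = (if K = {0} then 1 else 2 :: real)"

lemma \<kappa>_pos: "0 < \<kappa>"
  by (simp add: \<kappa>_def)

text \<open>Beyond a common index the finitely many centres are within \<open>\<eta>\<close> of
  their limits. Going from \<open>a n k\<close> to its centre, to the limit of that centre and on to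
  \<open>\<beta> k\<close> costs \<open>\<epsilon>\<close>, \<open>\<eta>\<close> and
  \<open>(\<kappa> - 1) * \<epsilon>\<close>.\<close>

lemma le_hausdorff_mnc_columns:
  assumes l: "\<forall>c r. (\<forall>n\<ge>r. \<forall>k. cmod (a n k - \<beta> k) \<le> c) \<longrightarrow> l \<le> c"
    and cover: "finite_ball_cover Y e (range (\<lambda>k n. a n k)) \<epsilon>"
  shows "l \<le> \<kappa> * \<epsilon>"
proof (rule field_le_epsilon)
  fix \<eta> :: real assume \<eta>: "0 < \<eta>"
  obtain Z where Z: "0 < \<epsilon>" "finite Z" "Z \<subseteq> Y" "range (\<lambda>k n. a n k) \<subseteq> Y"
    "\<And>y. y \<in> range (\<lambda>k n. a n k) \<Longrightarrow> \<exists>z\<in>Z. e z y < \<epsilon>"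
    using Y.finite_ball_coverE[OF cover] by blast
  obtain \<zeta> where \<zeta>: "\<And>z. z \<in> Z \<Longrightarrow> \<zeta> z \<in> K" "\<And>z. z \<in> Z \<Longrightarrow> z \<longlonglongrightarrow> \<zeta> z"
    using Z(3) by (simp add: lim_space_def subset_iff) metis
  have "\<forall>\<^sub>F n in sequentially. \<forall>z\<in>Z. dist (z n) (\<zeta> z) < \<eta>"
    using Z(2) \<zeta>(2) \<eta> by (intro eventually_ball_finite ballI tendstoD)
  then obtain r where r: "\<And>n z. r \<le> n \<Longrightarrow> z \<in> Z \<Longrightarrow> cmod (z n - \<zeta> z) < \<eta>"
    by (auto simp: eventually_sequentially dist_norm)
  show "l \<le> \<kappa> * \<epsilon> + \<eta>"
  proof (rule l[rule_format])
    fix n k assume n: "r \<le> n"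
    obtain z where z: "z \<in> Z" "e z (\<lambda>n. a n k) < \<epsilon>"
      using Z(5)[OF rangeI, of k] by blast
    have near: "cmod (z n - a n k) \<le> \<epsilon>" for n
      using norm_diff_le_dist[of z "\<lambda>n. a n k" n] z(2) subsetD[OF Z(3) z(1)] subsetD[OF Z(4) rangeI, of k]
      by simp
    have "cmod (\<zeta> z - \<beta> k) \<le> (\<kappa> - 1) * \<epsilon>"
    proof (cases "K = {0}")
      case True
      then show ?thesis
        unfolding \<kappa>_def using \<zeta>(1)[OF z(1)] \<beta>_eq_0[OF True] by auto
    next
      case False
      have "cmod (\<zeta> z - \<beta> k) \<le> \<epsilon>"
        by (rule LIMSEQ_le_const2[OF tendsto_norm[OF tendsto_diff[OF \<zeta>(2)[OF z(1)] \<beta>]]])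
           (use near in blast)
      with False show ?thesis
        by (simp add: \<kappa>_def)
    qed
    moreover have "cmod (a n k - \<beta> k) \<le> cmod (z n - a n k) + cmod (z n - \<zeta> z) + cmod (\<zeta> z - \<beta> k)"
      using norm_triangle_ineq[of "(a n k - z n) + (z n - \<zeta> z)" "\<zeta> z - \<beta> k"]
        norm_triangle_ineq[of "a n k - z n" "z n - \<zeta> z"]
      by (simp add: norm_minus_commute)
    ultimately show "cmod (a n k - \<beta> k) \<le> \<kappa> * \<epsilon> + \<eta>"
      using near[of n] r[OF n z(1)] by (simp add: algebra_simps)
  qed
qed

text \<open>The test set \<open>Q\<close> consists of the preimages of the unit vectors: it lies on
  the unit sphere, so its measure is at most 1, and its image is the set of columns of
  \<open>a\<close>.\<close>

lemma le_mnc_constant: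
  assumes l: "\<forall>c r. (\<forall>n\<ge>r. \<forall>k. cmod (a n k - \<beta> k) \<le> c) \<longrightarrow> l \<le> c"
    and C: "0 \<le> C" "\<And>Q. X.mbounded Q \<Longrightarrow>
      hausdorff_mnc Y e (mat_apply A ` Q) \<le> C * hausdorff_mnc X d Q"
  shows "l \<le> \<kappa> * C"
proof -
  define Q where "Q = {x \<in> X. \<exists>k. frac_diff \<alpha> x = (\<lambda>j. if j = k then 1 else 0)}"
  have zero: "(\<lambda>_. 0) \<in> X"
    by (simp add: l1_frac_space_def l1_space_def frac_diff_def)
  have dist: "d (\<lambda>_. 0) x = 1" if "x \<in> Q" for x
  proof -
    have "d (\<lambda>_. 0) x = d x (\<lambda>_. 0)"
      by (rule X.commute)
    also have "\<dots> = l1_norm (frac_diff \<alpha> x)"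
      using that zero by (simp add: norm_metric_def l1_frac_norm_def Q_def)
    also have "\<dots> = 1"
      using that l1_norm_unit by (auto simp: Q_def)
    finally show ?thesis .
  qed
  have image: "mat_apply A ` Q = range (\<lambda>k n. a n k)"
  proof (intro equalityI subsetI)
    fix y assume "y \<in> range (\<lambda>k n. a n k)"
    then obtain k where k: "y = (\<lambda>n. a n k)"
      by blast
    obtain x where x: "x \<in> X" "frac_diff \<alpha> x = (\<lambda>j. if j = k then 1 else 0)"
      by (rule frac_diff_surj[OF \<alpha> unit_in_l1])
    then show "y \<in> mat_apply A ` Q"
      unfolding k using assoc_matrix_column[OF \<alpha> A x, symmetric] by (auto simp: Q_def)
  qed (auto simp: Q_def assoc_matrix_column[OF \<alpha> A])
  have cover: "finite_ball_cover X d Q \<epsilon>" if "1 < \<epsilon>" for \<epsilon>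
    by (rule X.finite_ball_coverI[of "{\<lambda>_. 0}" _ 1]) (use that zero dist in \<open>auto simp: Q_def\<close>)
  have "hausdorff_mnc X d Q \<le> 1"
    using hausdorff_mnc_le[OF cover] by (rule dense_ge)
  moreover have "X.mbounded Q"
    unfolding X.mbounded_def
  proof (intro exI subsetI)
    show "x \<in> X.mcball (\<lambda>_. 0) 1" if "x \<in> Q" for x
      using zero dist[OF that] that by (simp add: Q_def)
  qed
  ultimately have "hausdorff_mnc Y e (mat_apply A ` Q) \<le> C"
    using C(2)[of Q] mult_left_mono[OF _ C(1), of "hausdorff_mnc X d Q" 1] by simp
  moreover have "l / \<kappa> \<le> hausdorff_mnc Y e (mat_apply A ` Q)"
  proof (rule le_hausdorff_mnc)
    \<comment> \<open>Only the existence of a cover matters here; it comes from the radius 2, the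
      crude bound \<open>2 * M\<close> and \<open>\<delta> = 1\<close>.\<close>
    show "finite_ball_cover Y e (mat_apply A ` Q) (2 * M * 2 + 2 * 1)"
    proof (rule finite_ball_cover_image[OF cover])
      show "cmod (a n k - \<beta> k) \<le> 2 * M" for n k
        using norm_triangle_ineq4[of "a n k" "\<beta> k"] M[of n k] norm_\<beta>_le[of k] by linarith
    qed simp_all
    show "l / \<kappa> \<le> \<epsilon>" if "finite_ball_cover Y e (mat_apply A ` Q) \<epsilon>" for \<epsilon>
      using le_hausdorff_mnc_columns[OF l that[unfolded image]] \<kappa>_pos by (simp add: field_simps)
  qed
  ultimately have "l / \<kappa> \<le> C"
    by linarith
  then show ?thesis
    using \<kappa>_pos by (simp add: field_simps)
qed

text \<open>The limit \<open>l\<close> is itself an admissible constant, and every admissible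
  \<open>C\<close> satisfies \<open>l \<le> \<kappa> * C\<close>; both pass to the infimum.\<close>

lemma mnc_norm_bounds:
  obtains l where
    "(\<lambda>r. SUP n\<in>{r..}. SUP k. ereal (cmod (a n k - \<beta> k))) \<longlonglongrightarrow> ereal l"
    "l \<le> \<kappa> * mnc_norm X d Y e (mat_apply A)" "mnc_norm X d Y e (mat_apply A) \<le> l"
proof -
  have "cmod (a n k - \<beta> k) \<le> 2 * M" for n k
    using norm_triangle_ineq4[of "a n k" "\<beta> k"] M[of n k] norm_\<beta>_le[of k] by linarith
  then obtain l where lim: "(\<lambda>r. SUP n\<in>{r..}. SUP k. ereal (cmod (a n k - \<beta> k))) \<longlonglongrightarrow> ereal l"
    and l: "0 \<le> l" "\<And>c. l < c \<Longrightarrow> \<exists>r. \<forall>n\<ge>r. \<forall>k. cmod (a n k - \<beta> k) \<le> c"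
      "\<forall>c r. (\<forall>n\<ge>r. \<forall>k. cmod (a n k - \<beta> k) \<le> c) \<longrightarrow> l \<le> c"
    using tail_SUP_tendsto[of "\<lambda>n k. cmod (a n k - \<beta> k)" "2 * M"] norm_ge_zero by blast
  let ?S = "{C. 0 \<le> C \<and> (\<forall>Q. X.mbounded Q \<longrightarrow>
    hausdorff_mnc Y e (mat_apply A ` Q) \<le> C * hausdorff_mnc X d Q)}"
  have mem: "l \<in> ?S"
    using l(1) hausdorff_mnc_image_le[OF l(1,2)] by simp
  have "mnc_norm X d Y e (mat_apply A) \<le> l"
    unfolding mnc_norm_def by (rule cInf_lower[OF mem]) (auto intro: bdd_belowI[of _ 0])
  moreover have "l / \<kappa> \<le> mnc_norm X d Y e (mat_apply A)"
    unfolding mnc_norm_def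
  proof (rule cInf_greatest)
    show "?S \<noteq> {}"
      using mem by blast
    show "l / \<kappa> \<le> C" if "C \<in> ?S" for C
      using le_mnc_constant[OF l(3), of C] that \<kappa>_pos by (simp add: field_simps)
  qed
  then have "l \<le> \<kappa> * mnc_norm X d Y e (mat_apply A)"
    using \<kappa>_pos by (simp add: field_simps)
  ultimately show thesis
    using that[OF lim] by blast
qed

end

section \<open>The two target spaces\<close>

theorem theorem3p8:
  fixes \<alpha> :: real and A :: "nat \<Rightarrow> nat \<Rightarrow> complex"
  assumes "\<alpha> \<notin> \<int>"
  shows
    "(A \<in> matrix_class (l1_frac_space \<alpha>) c0_space \<longrightarrow>
        (\<lambda>r. SUP n\<in>{r..}. SUP k. ereal (cmod (assoc_matrix \<alpha> A n k)))
          \<longlonglongrightarrow> ereal (mnc_norm (l1_frac_space \<alpha>) (l1_frac_metric \<alpha>)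
                       c0_space c0_metric (mat_apply A))) \<and>
     (A \<in> matrix_class (l1_frac_space \<alpha>) c_space \<longrightarrow>
        (\<exists>\<beta> :: nat \<Rightarrow> complex. \<exists>l :: real.
           (\<forall>k. (\<lambda>n. assoc_matrix \<alpha> A n k) \<longlonglongrightarrow> \<beta> k) \<and>
           (\<lambda>r. SUP n\<in>{r..}. SUP k. ereal (cmod (assoc_matrix \<alpha> A n k - \<beta> k)))
             \<longlonglongrightarrow> ereal l \<and>
           1 / 2 * l \<le> mnc_norm (l1_frac_space \<alpha>) (l1_frac_metric \<alpha>)
                         c_space c_metric (mat_apply A) \<and>
           mnc_norm (l1_frac_space \<alpha>) (l1_frac_metric \<alpha>)
             c_space c_metric (mat_apply A) \<le> l))"
proof (intro conjI impI)
  assume A: "A \<in> matrix_class (l1_frac_space \<alpha>) c0_space"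
  have "c0_space \<subseteq> c_space"
    by (auto simp: c0_space_def c_space_def convergent_def)
  then obtain M where M: "\<And>n k. cmod (assoc_matrix \<alpha> A n k) \<le> M"
    using assoc_matrix_bounded[OF assms A] by blast
  \<comment> \<open>The columns lie in \<open>c0_space\<close>, so their limits are 0 and the
    deviation from the limit is the entry itself.\<close>
  interpret matrix_into_lim_space \<alpha> A "{0}" "\<lambda>_. 0" M
    using assms A M assoc_matrix_column_in[OF assms A]
    by unfold_locales (auto simp: c0_space_eq_lim_space lim_space_def)
  have "\<kappa> = 1"
    by (simp add: \<kappa>_def)
  moreover obtain l where
    "(\<lambda>r. SUP n\<in>{r..}. SUP k. ereal (cmod (assoc_matrix \<alpha> A n k - 0))) \<longlonglongrightarrow> ereal l"
    "l \<le> \<kappa> * mnc_norm (l1_frac_space \<alpha>) (l1_frac_metric \<alpha>) c0_space c0_metric (mat_apply A)"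
    "mnc_norm (l1_frac_space \<alpha>) (l1_frac_metric \<alpha>) c0_space c0_metric (mat_apply A) \<le> l"
    using mnc_norm_bounds unfolding c0_space_eq_lim_space .
  ultimately show "(\<lambda>r. SUP n\<in>{r..}. SUP k. ereal (cmod (assoc_matrix \<alpha> A n k)))
      \<longlonglongrightarrow> ereal (mnc_norm (l1_frac_space \<alpha>) (l1_frac_metric \<alpha>) c0_space c0_metric (mat_apply A))"
    by simp
next
  assume A: "A \<in> matrix_class (l1_frac_space \<alpha>) c_space"
  obtain M where M: "\<And>n k. cmod (assoc_matrix \<alpha> A n k) \<le> M"
    using assoc_matrix_bounded[OF assms A] by blast
  \<comment> \<open>The column limits exist because each column is the image of a preimage of a unit
    vector.\<close>
  have "\<exists>\<beta>. \<forall>k. (\<lambda>n. assoc_matrix \<alpha> A n k) \<longlonglongrightarrow> \<beta> k"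
    using assoc_matrix_column_in[OF assms A]
    by (intro choice) (simp add: c_space_def convergent_def)
  then obtain \<beta> where \<beta>: "\<And>k. (\<lambda>n. assoc_matrix \<alpha> A n k) \<longlonglongrightarrow> \<beta> k"
    by blast
  interpret matrix_into_lim_space \<alpha> A UNIV \<beta> M
    using assms A M \<beta> by unfold_locales (auto simp: c_space_eq_lim_space)
  have "UNIV \<noteq> {0::complex}"
    by (metis UNIV_I singletonD zero_neq_one)
  then have "\<kappa> = 2"
    by (simp add: \<kappa>_def)
  moreover obtain l where
    "(\<lambda>r. SUP n\<in>{r..}. SUP k. ereal (cmod (assoc_matrix \<alpha> A n k - \<beta> k))) \<longlonglongrightarrow> ereal l"
    "l \<le> \<kappa> * mnc_norm (l1_frac_space \<alpha>) (l1_frac_metric \<alpha>) c_space c_metric (mat_apply A)"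
    "mnc_norm (l1_frac_space \<alpha>) (l1_frac_metric \<alpha>) c_space c_metric (mat_apply A) \<le> l"
    using mnc_norm_bounds unfolding c_space_eq_lim_space .
  ultimately show "\<exists>\<beta> l. (\<forall>k. (\<lambda>n. assoc_matrix \<alpha> A n k) \<longlonglongrightarrow> \<beta> k) \<and>
      (\<lambda>r. SUP n\<in>{r..}. SUP k. ereal (cmod (assoc_matrix \<alpha> A n k - \<beta> k))) \<longlonglongrightarrow> ereal l \<and>
      1 / 2 * l \<le> mnc_norm (l1_frac_space \<alpha>) (l1_frac_metric \<alpha>) c_space c_metric (mat_apply A) \<and>
      mnc_norm (l1_frac_space \<alpha>) (l1_frac_metric \<alpha>) c_space c_metric (mat_apply A) \<le> l"
    using \<beta> by (intro exI[of _ \<beta>] exI[of _ l]) simp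
qed

end
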